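(* Let $(V,b,m)$ be an infinite, locally finite, connected graph over a non-Archimedean ordered field $\mathbb K$ which is Cauchy complete and has countable cofinality. For $a\in V$, we have $$\mathrm{cap}(a)=\inf\{Q(\phi)\mid \phi\in C_c(V),\ \phi(a)=1\}$$ whenever either side exists (that is, if one of the two sides exists in $\mathbb K$, then so does the other and they are equal).
   Context: An ordered field $(\mathbb K,\succ)$ is non-Archimedean if there is $\tau\succ0$ with $\tau\prec 1/n$ for all $n\in\mathbb N$. $\mathbb K^+=\{k\in\mathbb K: k\succ0\}$. A sequence $(k_n)$ converges to $k\in\mathbb K$ if for every $c\in\mathbb K^+$ one has $|k_n-k|\preceq c$ for all large $n$. Cauchy complete: every Cauchy sequence converges. Countable cofinality: there is a countable $S\subset\mathbb K$ such that every $k\in\mathbb K$ satisfies $k\preceq s$ for some $s\in S$. The infimum of $A\subset\mathbb K$, if it exists, is the greatest lower bound of $A$ in $\mathbb K$ (it need not exist for sets bounded from below). A graph $(V,b,m)$ over $\mathbb K$: $V$ is an at most countable set, $m:V\to\mathbb K^+$, and $b:V\times V\to\mathbb K^+\cup\{0\}$ is symmetric with $b(x,x)=0$. Write $x\sim y$ if $b(x,y)\neq0$; locally finite means each vertex has finitely many neighbors; connectedness is with respect to paths $x_0\sim x_1\sim\dots\sim x_n$, and $d$ is the combinatorial graph distance. $B_n(a)=\{x\in V: d(a,x)<n\}$. Laplacian: $\Delta f(x)=\frac1{m(x)}\sum_{y\in V}(f(x)-f(y))b(x,y)$ for $f:V\to\mathbb K$. $C_c(V)$ is the set of finitely supported functions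 $V\to\mathbb K$, and $Q(\phi)=\frac12\sum_{x,y\in V}(\phi(x)-\phi(y))^2b(x,y)$ for $\phi\in C_c(V)$. For a finite connected $K\subseteq V$ and $a\in K$ there is a unique $v:V\to\mathbb K$ with $\Delta v=0$ on $K\setminus\{a\}$, $v(a)=1$, $v=0$ on $V\setminus K$; put $\mathrm{cap}_K(a)=\Delta v(a)m(a)$ and $\mathrm{cap}_n(a)=\mathrm{cap}_{B_n(a)}(a)$, $n\ge1$. The effective capacity is $\mathrm{cap}(a)=\lim_{n\to\infty}\mathrm{cap}_n(a)$ if this limit exists in $\mathbb K$. *)

theory Defs
  imports
    Complex_Main
    "HOL-Library.Countable_Set"
    "HOL-Library.Groups_Big_Fun"
    "HOL-Library.Lub_Glb"
begin

section \<open>Ordered fields\<close>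

text \<open>
  An ordered field is a type of class \<^class>\<open>linordered_field\<close>. That class carries no topology, so
  convergence is stated through the order, with tolerances taken from the field itself.
\<close>

definition non_archimedean :: "'k::linordered_field itself \<Rightarrow> bool" where
  "non_archimedean _ \<longleftrightarrow> (\<exists>\<tau>::'k. \<tau> > 0 \<and> (\<forall>n::nat. n \<ge> 1 \<longrightarrow> \<tau> < 1 / of_nat n))"

definition field_converges :: "(nat \<Rightarrow> 'k::linordered_field) \<Rightarrow> 'k \<Rightarrow> bool" where
  "field_converges s l \<longleftrightarrow> (\<forall>c>0. \<exists>N. \<forall>n\<ge>N. \<bar>s n - l\<bar> \<le> c)"

definition field_cauchy :: "(nat \<Rightarrow> 'k::linordered_field) \<Rightarrow> bool" where
  "field_cauchy s \<longleftrightarrow> (\<forall>c>0. \<exists>N. \<forall>i\<ge>N. \<forall>j\<ge>N. \<bar>s i - s j\<bar> \<le> c)"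

definition cauchy_complete :: "'k::linordered_field itself \<Rightarrow> bool" where
  "cauchy_complete _ \<longleftrightarrow> (\<forall>s::nat \<Rightarrow> 'k. field_cauchy s \<longrightarrow> (\<exists>l. field_converges s l))"

definition countable_cofinality :: "'k::linordered_field itself \<Rightarrow> bool" where
  "countable_cofinality _ \<longleftrightarrow> (\<exists>S::'k set. countable S \<and> (\<forall>k. \<exists>s\<in>S. k \<le> s))"

section \<open>Weighted graphs\<close>

text \<open>The vertex set is the whole type \<open>'v\<close>.\<close>

locale weighted_graph =
  fixes b :: "'v \<Rightarrow> 'v \<Rightarrow> 'k::linordered_field"
    and m :: "'v \<Rightarrow> 'k"
  assumes countable_vertices: "countable (UNIV :: 'v set)"
    and measure_pos: "m x > 0"
    and weight_nonneg: "b x y \<ge> 0"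
    and weight_sym: "b x y = b y x"
    and weight_diag: "b x x = 0"

definition adj :: "('v \<Rightarrow> 'v \<Rightarrow> 'k::linordered_field) \<Rightarrow> 'v \<Rightarrow> 'v \<Rightarrow> bool" where
  "adj b x y \<longleftrightarrow> b x y \<noteq> 0"

definition locally_finite :: "('v \<Rightarrow> 'v \<Rightarrow> 'k::linordered_field) \<Rightarrow> bool" where
  "locally_finite b \<longleftrightarrow> (\<forall>x. finite {y. adj b x y})"

definition connected_graph :: "('v \<Rightarrow> 'v \<Rightarrow> 'k::linordered_field) \<Rightarrow> bool" where
  "connected_graph b \<longleftrightarrow> (\<forall>x y. (adj b)\<^sup>*\<^sup>* x y)"

text \<open>
  \<open>(adj b ^^ n) x y\<close> says that there is a path with \<open>n\<close> edges from \<open>x\<close> to \<open>y\<close>. The value of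
  \<open>graph_dist\<close> is meaningful only if \<open>x\<close> and \<open>y\<close> are connected by a path.
\<close>

definition graph_dist :: "('v \<Rightarrow> 'v \<Rightarrow> 'k::linordered_field) \<Rightarrow> 'v \<Rightarrow> 'v \<Rightarrow> nat" where
  "graph_dist b x y = (LEAST n. (adj b ^^ n) x y)"

definition graph_ball :: "('v \<Rightarrow> 'v \<Rightarrow> 'k::linordered_field) \<Rightarrow> 'v \<Rightarrow> nat \<Rightarrow> 'v set" where
  "graph_ball b a n = {x. graph_dist b a x < n}"

section \<open>Laplacian and energy\<close>

text \<open>
  \<^const>\<open>Sum_any\<close> is the sum over the whole type of a finitely supported function. On a locally finite
  graph the summands below have finite support (for \<open>energy\<close>: if \<open>\<phi>\<close> is finitely supported); were it
  infinite, the sum would be \<open>0\<close> by convention.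
\<close>

definition laplacian ::
    "('v \<Rightarrow> 'v \<Rightarrow> 'k::linordered_field) \<Rightarrow> ('v \<Rightarrow> 'k) \<Rightarrow> ('v \<Rightarrow> 'k) \<Rightarrow> 'v \<Rightarrow> 'k" where
  "laplacian b m f x = 1 / m x * Sum_any (\<lambda>y. (f x - f y) * b x y)"

definition finitely_supported :: "('v \<Rightarrow> 'k::linordered_field) set" where
  "finitely_supported = {\<phi>. finite {x. \<phi> x \<noteq> 0}}"

definition energy :: "('v \<Rightarrow> 'v \<Rightarrow> 'k::linordered_field) \<Rightarrow> ('v \<Rightarrow> 'k) \<Rightarrow> 'k" where
  "energy b \<phi> = 1 / 2 * Sum_any (\<lambda>(x, y). (\<phi> x - \<phi> y)\<^sup>2 * b x y)"

section \<open>Capacity\<close>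

definition solves_dirichlet ::
    "('v \<Rightarrow> 'v \<Rightarrow> 'k::linordered_field) \<Rightarrow> ('v \<Rightarrow> 'k) \<Rightarrow> 'v set \<Rightarrow> 'v \<Rightarrow> ('v \<Rightarrow> 'k) \<Rightarrow> bool" where
  "solves_dirichlet b m K a v \<longleftrightarrow>
     (\<forall>x\<in>K - {a}. laplacian b m v x = 0) \<and> v a = 1 \<and> (\<forall>x\<in>- K. v x = 0)"

text \<open>
  For finite connected \<open>K\<close> containing \<open>a\<close>, in a locally finite connected graph, the Dirichlet problem
  has exactly one solution; other sets \<open>K\<close> are outside the scope of the definition of \<open>cap_on\<close>.
\<close>

definition cap_on ::
    "('v \<Rightarrow> 'v \<Rightarrow> 'k::linordered_field) \<Rightarrow> ('v \<Rightarrow> 'k) \<Rightarrow> 'v set \<Rightarrow> 'v \<Rightarrow> 'k" where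
  "cap_on b m K a = laplacian b m (THE v. solves_dirichlet b m K a v) a * m a"

text \<open>
  The ball with \<open>n = 0\<close> is empty, so \<open>cap_ball b m 0 a\<close> is an unspecified value; it does not influence
  the limit.
\<close>

definition cap_ball ::
    "('v \<Rightarrow> 'v \<Rightarrow> 'k::linordered_field) \<Rightarrow> ('v \<Rightarrow> 'k) \<Rightarrow> nat \<Rightarrow> 'v \<Rightarrow> 'k" where
  "cap_ball b m n a = cap_on b m (graph_ball b a n) a"

text \<open>
  The effective capacity need not exist, hence a relation: \<open>has_effective_capacity b m a c\<close> means that
  \<open>cap(a)\<close> exists and equals \<open>c\<close>. Likewise \<open>isGlb UNIV A c\<close> means that the infimum of \<open>A\<close> exists in
  the field and equals \<open>c\<close>.
\<close>

definition has_effective_capacity ::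
    "('v \<Rightarrow> 'v \<Rightarrow> 'k::linordered_field) \<Rightarrow> ('v \<Rightarrow> 'k) \<Rightarrow> 'v \<Rightarrow> 'k \<Rightarrow> bool" where
  "has_effective_capacity b m a c \<longleftrightarrow> field_converges (\<lambda>n. cap_ball b m n a) c"

end

(* By Green's formula the solution v of the Dirichlet problem on a ball minimises the energy among
   all functions with value 1 at a that vanish off the ball, and its energy is the capacity of the
   ball. So the capacities form a decreasing sequence whose lower bounds are those of the energies
   of all admissible functions. In any ordered field a decreasing sequence converges to c exactly if
   c is its infimum, since c + e fails to be a lower bound for every e > 0. *)
theory Submission
  imports Defs
begin

section \<open>Energy form and Green's formula\<close>

locale connected_locally_finite_graph = weighted_graph b m
  for b :: "'v \<Rightarrow> 'v \<Rightarrow> 'k::linordered_field" and m :: "'v \<Rightarrow> 'k" +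
  assumes locally_finite: "locally_finite b"
    and connected: "connected_graph b"
begin

text \<open>The symmetric bilinear form behind the quadratic form \<open>energy\<close>;
  orthogonality of Dirichlet solutions is expressed through it.\<close>

definition energy_form :: "('v \<Rightarrow> 'k) \<Rightarrow> ('v \<Rightarrow> 'k) \<Rightarrow> 'k" where
  "energy_form f g = 1 / 2 * Sum_any (\<lambda>(x, y). (f x - f y) * (g x - g y) * b x y)"

lemma energy_form_self: "energy_form f f = energy b f"
  by (simp add: energy_form_def energy_def power2_eq_square)

lemma finite_neighbours: "finite {y. b x y \<noteq> 0}"
  using locally_finite by (simp add: locally_finite_def adj_def)

lemma finite_edges_meeting:
  assumes "finite S"
  shows "finite {(x, y). (x \<in> S \<or> y \<in> S) \<and> b x y \<noteq> 0}"
proof -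
  let ?N = "Sigma S (\<lambda>x. {y. b x y \<noteq> 0})"
  have "{(x, y). (x \<in> S \<or> y \<in> S) \<and> b x y \<noteq> 0} \<subseteq> ?N \<union> prod.swap ` ?N"
    using weight_sym by (force simp: image_iff)
  moreover have "finite (?N \<union> prod.swap ` ?N)"
    using assms finite_neighbours by auto
  ultimately show ?thesis by (rule finite_subset)
qed

text \<open>A nonzero summand needs an edge on which \<open>g\<close> changes, hence an endpoint in
  \<open>S\<close>; \<open>f\<close> may be arbitrary.\<close>

lemma finite_support_energy_form:
  assumes "finite S" "\<forall>x\<in>- S. g x = 0"
  shows "finite {p. (case p of (x, y) \<Rightarrow> (f x - f y) * (g x - g y) * b x y) \<noteq> 0}"
  by (rule finite_subset[OF _ finite_edges_meeting[OF assms(1)]]) (use assms(2) in force)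

text \<open>The freedom in \<open>T\<close> allows one common range for the neighbour sums of many
  vertices.\<close>

lemma laplacian_times_measure:
  assumes "finite T" "{y. b x y \<noteq> 0} \<subseteq> T"
  shows "laplacian b m f x * m x = (\<Sum>y\<in>T. (f x - f y) * b x y)"
proof -
  have "Sum_any (\<lambda>y. (f x - f y) * b x y) = (\<Sum>y\<in>T. (f x - f y) * b x y)"
    using assms by (intro Sum_any.expand_superset) auto
  then show ?thesis
    using measure_pos[of x] by (simp add: laplacian_def)
qed

lemma laplacian_add_scaled:
  "laplacian b m (\<lambda>x. f x + t * g x) x * m x
    = laplacian b m f x * m x + t * (laplacian b m g x * m x)"
  unfolding laplacian_times_measure[OF finite_neighbours order_refl]
  by (simp add: sum_distrib_left sum.distrib[symmetric] algebra_simps)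

text \<open>Splitting \<open>g x - g y\<close> and exchanging \<open>x\<close> and \<open>y\<close>
  by symmetry of \<open>b\<close> gives two equal sums, which absorb the factor 1/2.\<close>

lemma green_formula:
  assumes S: "finite S" "\<forall>x\<in>- S. g x = 0"
  shows "energy_form f g = (\<Sum>x\<in>S. g x * (laplacian b m f x * m x))"
proof -
  \<comment> \<open>\<open>T\<close> contains both ends of every edge meeting \<open>S\<close>, so
    all neighbours of vertices in \<open>S\<close>; vertices of \<open>T - S\<close> drop out at the
    end because \<open>g\<close> vanishes there.\<close>
  define T where "T = S \<union> (\<Union>x\<in>S. {y. b x y \<noteq> 0})"
  have T: "finite T" "S \<subseteq> T" "\<And>x. x \<in> S \<Longrightarrow> {y. b x y \<noteq> 0} \<subseteq> T"
    using S(1) finite_neighbours by (auto simp: T_def)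
  have "Sum_any (\<lambda>(x, y). (f x - f y) * (g x - g y) * b x y)
      = (\<Sum>(x, y)\<in>T \<times> T. (f x - f y) * (g x - g y) * b x y)"
  proof (rule Sum_any.expand_superset)
    show "{p. (case p of (x, y) \<Rightarrow> (f x - f y) * (g x - g y) * b x y) \<noteq> 0} \<subseteq> T \<times> T"
    proof clarify
      fix x y assume nz: "(f x - f y) * (g x - g y) * b x y \<noteq> 0"
      then have "x \<in> S \<or> y \<in> S" using S(2) by force
      moreover have "b x y \<noteq> 0" "b y x \<noteq> 0" using nz weight_sym[of x y] by auto
      ultimately show "x \<in> T \<and> y \<in> T" unfolding T_def by auto
    qed
  qed (use T in simp)
  also have "\<dots> = (\<Sum>x\<in>T. \<Sum>y\<in>T. g x * ((f x - f y) * b x y))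
      + (\<Sum>x\<in>T. \<Sum>y\<in>T. g y * ((f y - f x) * b x y))"
    by (simp add: sum.cartesian_product[symmetric] sum.distrib[symmetric] algebra_simps)
  also have "(\<Sum>x\<in>T. \<Sum>y\<in>T. g y * ((f y - f x) * b x y))
      = (\<Sum>x\<in>T. \<Sum>y\<in>T. g x * ((f x - f y) * b x y))"
    by (subst sum.swap) (simp add: weight_sym)
  also have "(\<Sum>x\<in>T. \<Sum>y\<in>T. g x * ((f x - f y) * b x y))
      = (\<Sum>x\<in>S. g x * (laplacian b m f x * m x))"
    by (rule sum.mono_neutral_cong_right)
      (use T S in \<open>auto simp: laplacian_times_measure[OF T(1)] sum_distrib_left\<close>)
  finally show ?thesis by (simp add: energy_form_def)
qed

section \<open>Positivity and expansion of the energy\<close>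

lemma energy_nonneg: "energy b f \<ge> 0"
  unfolding energy_def Sum_any.expand_set
  by (auto intro!: mult_nonneg_nonneg sum_nonneg weight_nonneg)

text \<open>Nonnegative edge terms with sum 0 all vanish, so \<open>f\<close> is constant along
  edges and, by connectedness, equal to \<open>f a\<close>.\<close>

lemma energy_eq_0_imp_zero:
  assumes "finite S" "\<forall>x\<in>- S. f x = 0" "energy b f = 0" "f a = 0"
  shows "f z = 0"
proof -
  let ?h = "\<lambda>(x, y). (f x - f y)\<^sup>2 * b x y"
  have fin: "finite {p. ?h p \<noteq> 0}"
    using finite_support_energy_form[OF assms(1,2), of f] by (simp add: power2_eq_square)
  have "sum ?h {p. ?h p \<noteq> 0} = 0"
    using assms(3) by (simp add: energy_def Sum_any.expand_set)
  then have "\<forall>p\<in>{p. ?h p \<noteq> 0}. ?h p = 0"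
    using fin weight_nonneg by (subst (asm) sum_nonneg_eq_0_iff) auto
  then have edge: "f x = f y" if "adj b x y" for x y
    using that by (auto simp: adj_def)
  have "(adj b)\<^sup>*\<^sup>* a z"
    using connected by (simp add: connected_graph_def)
  then show ?thesis
    by induction (use assms(4) edge in auto)
qed

lemma energy_add:
  assumes "finite S" "\<forall>x\<in>- S. f x = 0" "\<forall>x\<in>- S. g x = 0"
  shows "energy b (\<lambda>x. f x + g x) = energy b f + 2 * energy_form f g + energy b g"
proof -
  \<comment> \<open>A common finite set of edges makes the expansion a termwise identity.\<close>
  let ?E = "{(x, y). (x \<in> S \<or> y \<in> S) \<and> b x y \<noteq> 0}"
  have E: "energy_form p q = 1 / 2 * (\<Sum>(x, y)\<in>?E. (p x - p y) * (q x - q y) * b x y)"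
    if "\<forall>x\<in>- S. q x = 0" for p q
    unfolding energy_form_def
    by (subst Sum_any.expand_superset[OF finite_edges_meeting[OF assms(1)]]) (use that in force)+
  show ?thesis
    unfolding energy_form_self[symmetric]
    by (simp add: E assms sum_distrib_left sum.distrib[symmetric] case_prod_unfold algebra_simps)
qed

section \<open>Existence and uniqueness for the Dirichlet problem\<close>

text \<open>A vertex \<open>z\<close> is added to \<open>F\<close> by superposing the solution \<open>u\<close> with boundary value 1 at
  \<open>z\<close>: its net flow at \<open>z\<close> is its energy, hence nonzero.\<close>

lemma dirichlet_problem_solvable:
  assumes "finite F" "a \<notin> F" "h \<in> finitely_supported"
  shows "\<exists>v. (\<forall>x\<in>F. laplacian b m v x = 0) \<and> (\<forall>x. x \<notin> F \<longrightarrow> v x = h x)"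
  using assms
proof (induction F arbitrary: h rule: finite_induct)
  case empty
  then show ?case by blast
next
  case (insert z F)
  obtain v where v: "\<And>x. x \<in> F \<Longrightarrow> laplacian b m v x = 0" "\<And>x. x \<notin> F \<Longrightarrow> v x = h x"
    using insert.IH[of h] insert.prems by auto
  have "(\<lambda>x. if x = z then 1 else 0) \<in> finitely_supported"
    by (simp add: finitely_supported_def)
  then obtain u where u: "\<And>x. x \<in> F \<Longrightarrow> laplacian b m u x = 0"
      "\<And>x. x \<notin> F \<Longrightarrow> u x = (if x = z then 1 else 0)"
    using insert.IH[of "\<lambda>x. if x = z then 1 else 0"] insert.prems by auto
  have supp: "finite (insert z F)" "\<forall>x\<in>- insert z F. u x = 0"
    using insert.hyps u(2) by auto
  have "energy b u = laplacian b m u z * m z"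
    using green_formula[OF supp, of u] insert.hyps u
    by (simp add: energy_form_self)
  \<comment> \<open>Zero energy and \<open>u a = 0\<close> would force \<open>u z = 0\<close>, but
    \<open>u z = 1\<close>.\<close>
  moreover have "energy b u \<noteq> 0"
    using energy_eq_0_imp_zero[OF supp, of a z] u(2) insert.hyps insert.prems by auto
  ultimately have flow: "laplacian b m u z * m z \<noteq> 0" by simp
  \<comment> \<open>This \<open>t\<close> cancels the net flow of \<open>v\<close> at
    \<open>z\<close>; on \<open>F\<close> both functions are already harmonic.\<close>
  define t where "t = - (laplacian b m v z * m z) / (laplacian b m u z * m z)"
  let ?w = "\<lambda>x. v x + t * u x"
  have "laplacian b m ?w x * m x = 0" if "x \<in> insert z F" for x
    unfolding laplacian_add_scaled using that flow u(1) v(1) by (auto simp: t_def)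
  then have "laplacian b m ?w x = 0" if "x \<in> insert z F" for x
    using that measure_pos[of x] by (metis mult_eq_0_iff less_irrefl)
  then show ?case
    using u(2) v(2) by (intro exI[of _ ?w]) auto
qed

text \<open>Every term of Green's formula vanishes: at \<open>a\<close> through \<open>g\<close>,
  elsewhere in \<open>K\<close> through harmonicity of \<open>v\<close>.\<close>

lemma solves_dirichlet_orthogonal:
  assumes "finite K" "solves_dirichlet b m K a v"
    and "\<forall>x\<in>- K. g x = 0" "g a = 0"
  shows "energy_form v g = 0"
proof -
  have "g x * (laplacian b m v x * m x) = 0" if "x \<in> K" for x
    using assms that by (cases "x = a") (auto simp: solves_dirichlet_def)
  then show ?thesis
    unfolding green_formula[OF assms(1,3)] by (intro sum.neutral) blast
qed

text \<open>Pythagoras: \<open>\<phi> - v\<close> vanishes at \<open>a\<close> and off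
  \<open>K\<close>, hence is orthogonal to \<open>v\<close>.\<close>

lemma energy_decomposition:
  assumes K: "finite K" and v: "solves_dirichlet b m K a v"
    and \<phi>: "\<forall>x\<in>- K. \<phi> x = 0" "\<phi> a = 1"
  shows "energy b \<phi> = energy b v + energy b (\<lambda>x. \<phi> x - v x)"
proof -
  have v0: "\<forall>x\<in>- K. v x = 0"
    using v by (simp add: solves_dirichlet_def)
  have "energy_form v (\<lambda>x. \<phi> x - v x) = 0"
    using v by (intro solves_dirichlet_orthogonal[OF K v])
      (auto simp: v0 \<phi> solves_dirichlet_def)
  then show ?thesis
    using energy_add[OF K, of v "\<lambda>x. \<phi> x - v x"] by (simp add: v0 \<phi>)
qed

lemma ex1_solves_dirichlet:
  assumes "finite K" "a \<in> K"
  shows "\<exists>!v. solves_dirichlet b m K a v"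
proof -
  \<comment> \<open>The vertex \<open>a\<close> is treated as a boundary vertex with value 1,
    leaving \<open>K - {a}\<close> as the interior.\<close>
  have "(\<lambda>x. if x = a then 1 else 0) \<in> finitely_supported"
    by (simp add: finitely_supported_def)
  then obtain v where v: "\<forall>x\<in>K - {a}. laplacian b m v x = 0"
      "\<forall>x. x \<notin> K - {a} \<longrightarrow> v x = (if x = a then 1 else 0)"
    using dirichlet_problem_solvable[of "K - {a}" a "\<lambda>x. if x = a then 1 else 0"] assms by auto
  have sol: "solves_dirichlet b m K a v"
    using v assms(2) by (auto simp: solves_dirichlet_def)
  have "w = v" if w: "solves_dirichlet b m K a w" for w
  proof
    fix z
    let ?d = "\<lambda>x. w x - v x"
    have d: "\<forall>x\<in>- K. ?d x = 0" "?d a = 0"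
      using w sol by (auto simp: solves_dirichlet_def)
    \<comment> \<open>Each solution competes against the other; adding both identities leaves two
      nonnegative energies with sum 0.\<close>
    have "energy b w = energy b v + energy b ?d" "energy b v = energy b w + energy b (\<lambda>x. v x - w x)"
      using w sol
      by (intro energy_decomposition[OF assms(1), of a]; simp add: solves_dirichlet_def)+
    then have "energy b ?d = 0"
      using energy_nonneg[of ?d] energy_nonneg[of "\<lambda>x. v x - w x"] by linarith
    then show "w z = v z"
      using energy_eq_0_imp_zero[OF assms(1) d(1), of a z] d(2) by auto
  qed
  with sol show ?thesis by blast
qed

section \<open>Capacity as minimal energy\<close>

text \<open>Green's formula for \<open>v\<close> against itself leaves only the term at
  \<open>a\<close>, which is the capacity; minimality is Pythagoras with a nonnegative
  remainder.\<close>

lemma cap_on_minimizer: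
  assumes "finite K" "a \<in> K"
  obtains v where "\<forall>x\<in>- K. v x = 0" "v a = 1" "energy b v = cap_on b m K a"
    "\<And>\<phi>. \<forall>x\<in>- K. \<phi> x = 0 \<Longrightarrow> \<phi> a = 1 \<Longrightarrow> cap_on b m K a \<le> energy b \<phi>"
proof -
  define v where "v = (THE v. solves_dirichlet b m K a v)"
  have v: "solves_dirichlet b m K a v"
    unfolding v_def using ex1_solves_dirichlet[OF assms] by (rule theI')
  then have v0: "\<forall>x\<in>- K. v x = 0" and va: "v a = 1"
    by (auto simp: solves_dirichlet_def)
  have "energy b v = (\<Sum>x\<in>K. v x * (laplacian b m v x * m x))"
    using green_formula[OF assms(1) v0, of v] by (simp add: energy_form_self)
  also have "\<dots> = (\<Sum>x\<in>{a}. v x * (laplacian b m v x * m x))"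
    using assms v by (intro sum.mono_neutral_right) (auto simp: solves_dirichlet_def)
  also have "\<dots> = cap_on b m K a"
    by (simp add: va cap_on_def v_def[symmetric])
  finally have cap: "energy b v = cap_on b m K a" .
  moreover have "cap_on b m K a \<le> energy b \<phi>" if "\<forall>x\<in>- K. \<phi> x = 0" "\<phi> a = 1" for \<phi>
    using energy_decomposition[OF assms(1) v that] energy_nonneg[of "\<lambda>x. \<phi> x - v x"] cap by simp
  ultimately show thesis
    using that v0 va by blast
qed

section \<open>Exhaustion by balls\<close>

lemma finite_graph_ball: "finite (graph_ball b a n)"
proof -
  have sphere: "finite {x. (adj b ^^ k) a x}" for k
  proof (induction k)
    case (Suc k)
    have "{x. (adj b ^^ Suc k) a x} = (\<Union>y\<in>{y. (adj b ^^ k) a y}. {x. b y x \<noteq> 0})"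
      by (auto simp: adj_def)
    with Suc finite_neighbours show ?case by auto
  qed auto
  have "graph_ball b a n \<subseteq> (\<Union>k<n. {x. (adj b ^^ k) a x})"
  proof
    fix x assume x: "x \<in> graph_ball b a n"
    \<comment> \<open>Connectedness provides some path, so the \<open>LEAST\<close> in
      \<open>graph_dist\<close> is attained.\<close>
    obtain k where "(adj b ^^ k) a x"
      using connected by (metis connected_graph_def rtranclp_imp_relpowp)
    then have "(adj b ^^ graph_dist b a x) a x"
      unfolding graph_dist_def by (rule LeastI)
    with x show "x \<in> (\<Union>k<n. {x. (adj b ^^ k) a x})"
      by (auto simp: graph_ball_def)
  qed
  with sphere show ?thesis by (meson finite_UN finite_lessThan finite_subset)
qed

lemma centre_in_graph_ball: "n \<ge> 1 \<Longrightarrow> a \<in> graph_ball b a n"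
  by (simp add: graph_ball_def graph_dist_def)

lemma finite_subset_graph_ball:
  assumes "finite S"
  obtains n where "n \<ge> 1" "S \<subseteq> graph_ball b a n"
proof
  \<comment> \<open>\<open>Suc\<close> is due to the strict inequality in \<open>graph_ball\<close>;
    for empty \<open>S\<close> the unspecified \<open>Max\<close> is harmless.\<close>
  show "S \<subseteq> graph_ball b a (Suc (Max (graph_dist b a ` S)))"
    using assms by (auto simp: graph_ball_def less_Suc_eq_le)
qed simp

text \<open>The minimiser on the smaller ball is a competitor on the larger one.\<close>

lemma cap_ball_antimono:
  assumes "1 \<le> i" "i \<le> j"
  shows "cap_ball b m j a \<le> cap_ball b m i a"
proof -
  obtain v where v: "\<forall>x\<in>- graph_ball b a i. v x = 0" "v a = 1"
      "energy b v = cap_ball b m i a"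
    using cap_on_minimizer[OF finite_graph_ball centre_in_graph_ball[OF assms(1)]]
    unfolding cap_ball_def by blast
  have "graph_ball b a i \<subseteq> graph_ball b a j"
    using assms(2) by (auto simp: graph_ball_def)
  with v(1) have "\<forall>x\<in>- graph_ball b a j. v x = 0" by blast
  then have "cap_ball b m j a \<le> energy b v"
    using cap_on_minimizer[OF finite_graph_ball centre_in_graph_ball[of j a]] assms v(2)
    unfolding cap_ball_def by (metis order_trans)
  with v(3) show ?thesis by simp
qed

lemma cap_ball_is_energy:
  assumes "n \<ge> 1"
  shows "\<exists>\<phi>\<in>finitely_supported. \<phi> a = 1 \<and> energy b \<phi> = cap_ball b m n a"
proof -
  obtain v where v: "\<forall>x\<in>- graph_ball b a n. v x = 0" "v a = 1"
      "energy b v = cap_ball b m n a"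
    using cap_on_minimizer[OF finite_graph_ball centre_in_graph_ball[OF assms]]
    unfolding cap_ball_def by blast
  have "v \<in> finitely_supported"
    unfolding finitely_supported_def
    using v(1) by (auto intro: finite_subset[OF _ finite_graph_ball[of a n]])
  with v show ?thesis by blast
qed

text \<open>A finite support lies in some ball, where \<open>\<phi>\<close> becomes a competitor.
  Together with \<open>cap_ball_is_energy\<close> this gives capacities and energies the same lower
  bounds.\<close>

lemma cap_ball_le_energy:
  assumes "\<phi> \<in> finitely_supported" "\<phi> a = 1"
  shows "\<exists>n\<ge>1. cap_ball b m n a \<le> energy b \<phi>"
proof -
  obtain n where n: "n \<ge> 1" "{x. \<phi> x \<noteq> 0} \<subseteq> graph_ball b a n"
    using finite_subset_graph_ball assms(1) unfolding finitely_supported_def by blast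
  then have "\<forall>x\<in>- graph_ball b a n. \<phi> x = 0" by blast
  then have "cap_ball b m n a \<le> energy b \<phi>"
    using cap_on_minimizer[OF finite_graph_ball centre_in_graph_ball[OF n(1)]] assms(2)
    unfolding cap_ball_def by metis
  with n(1) show ?thesis by blast
qed

end

section \<open>Limits of decreasing sequences as infima\<close>

lemma decreasing_converges_iff_isGlb:
  fixes s :: "nat \<Rightarrow> 'k::linordered_field"
  assumes dec: "\<And>i j. N \<le> i \<Longrightarrow> i \<le> j \<Longrightarrow> s j \<le> s i"
    and sub: "\<And>n. N \<le> n \<Longrightarrow> s n \<in> A"
    and dom: "\<And>x. x \<in> A \<Longrightarrow> \<exists>n\<ge>N. s n \<le> x"
  shows "field_converges s c \<longleftrightarrow> isGlb UNIV A c"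
proof
  assume conv: "field_converges s c"
  have near: "\<exists>n\<ge>k. \<bar>s n - c\<bar> \<le> e" if "e > 0" for k e
    using conv that unfolding field_converges_def by (metis max.cobounded1 max.cobounded2)
  have "c \<le> s n" if "N \<le> n" for n
  proof (rule ccontr)
    assume "\<not> c \<le> s n"
    \<comment> \<open>Past \<open>n\<close> the sequence stays below \<open>s n\<close>, so it
      cannot come within half the gap of \<open>c\<close>.\<close>
    then obtain k where "k \<ge> n" "\<bar>s k - c\<bar> \<le> (c - s n) / 2"
      using near[of "(c - s n) / 2" n] by auto
    moreover have "s k \<le> s n" using dec \<open>N \<le> n\<close> \<open>k \<ge> n\<close> by blast
    ultimately show False using \<open>\<not> c \<le> s n\<close> by (simp add: abs_le_iff field_simps)
  qed
  then have "c \<le> x" if "x \<in> A" for x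
    using dom[OF that] order_trans by blast
  moreover have "l \<le> c" if l: "\<And>x. x \<in> A \<Longrightarrow> l \<le> x" for l
  proof (rule field_le_epsilon)
    fix e :: 'k assume "e > 0"
    then obtain n where "n \<ge> N" "\<bar>s n - c\<bar> \<le> e" using near by blast
    with l[OF sub[OF \<open>n \<ge> N\<close>]] show "l \<le> c + e" by (simp add: abs_le_iff)
  qed
  ultimately show "isGlb UNIV A c"
    by (auto simp: isGlb_def greatestP_def isLb_def setle_def setge_def)
next
  assume glb: "isGlb UNIV A c"
  then have lb: "\<And>x. x \<in> A \<Longrightarrow> c \<le> x" and gr: "\<And>l. (\<And>x. x \<in> A \<Longrightarrow> l \<le> x) \<Longrightarrow> l \<le> c"
    by (auto simp: isGlb_def greatestP_def isLb_def setle_def setge_def)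
  show "field_converges s c"
    unfolding field_converges_def
  proof (intro allI impI)
    fix e :: 'k assume "e > 0"
    \<comment> \<open>Being above the greatest lower bound, \<open>c + e\<close> is not a lower
      bound; monotonicity then traps the tail between \<open>c\<close> and
      \<open>c + e\<close>.\<close>
    then obtain x where "x \<in> A" "x < c + e"
      using gr[of "c + e"] by (metis less_add_same_cancel1 not_le)
    then obtain n where n: "n \<ge> N" "s n < c + e"
      using dom by (meson order.strict_trans1)
    have "\<bar>s k - c\<bar> \<le> e" if "k \<ge> n" for k
      using dec[OF n(1) that] lb[OF sub[of k]] n that by (simp add: abs_le_iff)
    then show "\<exists>N. \<forall>k\<ge>N. \<bar>s k - c\<bar> \<le> e" by blast
  qed
qed

theorem theorem4p1:
  fixes b :: "'v \<Rightarrow> 'v \<Rightarrow> 'k::linordered_field"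
    and m :: "'v \<Rightarrow> 'k"
    and a :: 'v
  assumes "non_archimedean TYPE('k)"
    and "cauchy_complete TYPE('k)"
    and "countable_cofinality TYPE('k)"
    and "weighted_graph b m"
    and "infinite (UNIV :: 'v set)"
    and "locally_finite b"
    and "connected_graph b"
  shows "\<forall>c. has_effective_capacity b m a c \<longleftrightarrow>
             isGlb UNIV {energy b \<phi> |\<phi>. \<phi> \<in> finitely_supported \<and> \<phi> a = 1} c"
proof
  fix c
  interpret connected_locally_finite_graph b m
    using assms by (simp add: connected_locally_finite_graph_def
        connected_locally_finite_graph_axioms_def)
  let ?A = "{energy b \<phi> |\<phi>. \<phi> \<in> finitely_supported \<and> \<phi> a = 1}"
  show "has_effective_capacity b m a c \<longleftrightarrow> isGlb UNIV ?A c"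
    unfolding has_effective_capacity_def
  \<comment> \<open>The starting index is 1, since the ball of radius 0 is empty and its capacity
    unspecified.\<close>
  proof (rule decreasing_converges_iff_isGlb)
    show "cap_ball b m j a \<le> cap_ball b m i a" if "1 \<le> i" "i \<le> j" for i j
      using that by (rule cap_ball_antimono)
    show "cap_ball b m n a \<in> ?A" if "1 \<le> n" for n
      using cap_ball_is_energy[OF that, of a] by force
    show "\<exists>n\<ge>1. cap_ball b m n a \<le> x" if "x \<in> ?A" for x
      using that cap_ball_le_energy by blast
  qed
qed

end
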